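(* Let $R\subset\mathbb{N}$ be a good set and $\alpha$ an irrational number. Suppose the nonnegative function $\rho\in L^1(\mu_{R,\alpha})$ with $\int_{\mathbb{T}}\rho\,d\mu_{R,\alpha}=1$ is unbounded (i.e. $\|\rho\|_{L^\infty(\mu_{R,\alpha})}=\infty$), and that the good set $S\subset R$ represents the measure $\rho\cdot\mu_{R,\alpha}$ at $\alpha$, that is, $\mu_{S,\alpha}=\rho\cdot\mu_{R,\alpha}$. Then $S$ has mean $0$ in $R$, i.e. $M_R(S)=0$.
   Context: $\mathbb{N}=\{1,2,3,\dots\}$, $\mathbb{T}=\mathbb{R}/\mathbb{Z}$ and $e(\beta)=e^{2\pi i\beta}$. A good set $S\subset\mathbb{N}$ is an infinite set of positive integers which, when listed in increasing order as $s_1<s_2<\dots$, has the property that $\lim_{N\to\infty}\frac1N\sum_{n=1}^N e(s_n\beta)$ exists for every real number $\beta$. For a good set $S$ and every $\beta\in\mathbb{T}$, the weak limit of probability measures $\mu_{S,\beta}:=\lim_{N\to\infty}\frac1N\sum_{n=1}^N\delta_{s_n\beta}$ on $\mathbb{T}$ exists (with $s_n\beta$ taken mod $1$). For $R\subset\mathbb{N}$ write $R(N)=R\cap[1,N]$. For $S\subset R$, the relative mean of $S$ in $R$ is $M_R(S)=\lim_{N\to\infty}\frac{\#S(N)}{\#R(N)}$, provided the limit exists (the conclusion includes its existence). *)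

theory Defs
  imports "HOL-Probability.Probability"
begin

quotient_type torus = real / "\<lambda>x y :: real. x - y \<in> \<int>"
  morphisms rep_torus of_real_torus
proof (rule equivpI)
  show "reflp (\<lambda>x y :: real. x - y \<in> \<int>)"
    by (simp add: reflp_def)
  show "symp (\<lambda>x y :: real. x - y \<in> \<int>)"
    by (metis (mono_tags, lifting) Ints_minus minus_diff_eq sympI)
  show "transp (\<lambda>x y :: real. x - y \<in> \<int>)"
  proof (rule transpI)
    fix x y z :: real
    assume "x - y \<in> \<int>" "y - z \<in> \<int>"
    then have "(x - y) + (y - z) \<in> \<int>" by (rule Ints_add)
    then show "x - z \<in> \<int>" by simp
  qed
qed

text \<open>The torus carries the quotient topology, so that \<open>borel :: torus measure\<close> is its
  Borel sigma-algebra.\<close>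

instantiation torus :: topological_space
begin

definition open_torus :: "torus set \<Rightarrow> bool" where
  "open_torus U \<longleftrightarrow> open (of_real_torus -` U)"

instance
proof
  show "open (UNIV :: torus set)" by (simp add: open_torus_def)
  show "open (U \<inter> V)" if "open U" "open V" for U V :: "torus set"
    using that by (simp add: open_torus_def vimage_Int open_Int)
  show "open (\<Union>K)" if "\<forall>U\<in>K. open U" for K :: "torus set set"
    using that by (auto simp: open_torus_def vimage_Union intro!: open_UN)
qed

end

definition e :: "real \<Rightarrow> complex" where
  "e \<beta> = exp (2 * of_real pi * \<i> * of_real \<beta>)"

text \<open>\<open>enumerate S\<close> lists \<open>S\<close> increasingly starting from index 0, i.e. the element
  $s_{n+1}$ is \<open>enumerate S n\<close>; averages over $1 \le n \le N$ become averages over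
  \<open>n < N\<close>.\<close>

definition good :: "nat set \<Rightarrow> bool" where
  "good S \<longleftrightarrow> infinite S \<and> 0 \<notin> S \<and>
    (\<forall>\<beta> :: real. convergent
      (\<lambda>N. (\<Sum>n<N. e (real (enumerate S n) * \<beta>)) / of_nat N))"

text \<open>The library notion \<open>weak_conv_m\<close> is restricted to measures on the real line.
  As the torus is compact, its continuous functions are automatically bounded.\<close>

definition weak_limit :: "(nat \<Rightarrow> torus measure) \<Rightarrow> torus measure \<Rightarrow> bool" where
  "weak_limit M \<mu> \<longleftrightarrow> prob_space \<mu> \<and> sets \<mu> = sets borel \<and>
    (\<forall>f :: torus \<Rightarrow> real. continuous_on UNIV f \<longrightarrow>
      (\<lambda>N. \<integral>x. f x \<partial>M N) \<longlonglongrightarrow> (\<integral>x. f x \<partial>\<mu>))"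

text \<open>The empirical measure $\frac1N \sum_{n=1}^N \delta_{s_n \beta}$, as the image of the
  uniform probability measure on the \<open>N\<close> indices (for \<open>N > 0\<close>).\<close>

definition empirical_measure :: "nat set \<Rightarrow> real \<Rightarrow> nat \<Rightarrow> torus measure" where
  "empirical_measure S \<beta> N =
    distr (uniform_count_measure {..<N}) borel
      (\<lambda>n. of_real_torus (real (enumerate S n) * \<beta>))"

text \<open>Meaningful for good \<open>S\<close>, where the weak limit exists and is unique.\<close>

definition limit_measure :: "nat set \<Rightarrow> real \<Rightarrow> torus measure" where
  "limit_measure S \<beta> = (THE \<mu>. weak_limit (empirical_measure S \<beta>) \<mu>)"

definition has_relative_mean :: "nat set \<Rightarrow> nat set \<Rightarrow> real \<Rightarrow> bool" where
  "has_relative_mean R S m \<longleftrightarrow>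
    (\<lambda>N. real (card (S \<inter> {1..N})) / real (card (R \<inter> {1..N}))) \<longlonglongrightarrow> m"

end

theory Submission
  imports Defs
begin

text \<open>
  A positive upper density of \<open>S\<close> in \<open>R\<close> bounds \<open>\<rho>\<close> from above. Suppose that
  \<open>#S(N) \<ge> \<delta> #R(N)\<close> for infinitely many \<open>N\<close>. For such \<open>N\<close> and every continuous
  \<open>f \<ge> 0\<close> on the torus, the average of \<open>f (s \<alpha>)\<close> over \<open>s \<in> S(N)\<close> is at most \<open>1/\<delta>\<close> times
  the average over \<open>R(N)\<close>, because the sum over \<open>S(N)\<close> is part of the sum over \<open>R(N)\<close>. Since both
  averages converge along all of \<open>N\<close>, the limits satisfy
  \<open>\<integral> f d\<mu>\<^sub>S \<le> (1/\<delta>) \<integral> f d\<mu>\<^sub>R\<close> (\<open>integral_limit_measure_le\<close>). Such an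
  inequality for all continuous \<open>f \<ge> 0\<close> passes to all Borel sets
  (\<open>emeasure_le_if_integral_continuous_le\<close>), and for a measure with density \<open>\<rho>\<close> it says that
  \<open>\<rho> \<le> 1/\<delta>\<close> almost everywhere (\<open>AE_le_if_density_le\<close>), so \<open>\<rho>\<close> is essentially bounded.

  The limit measure is given by a definite description, so its weak limit property requires that
  the weak limit exists and is unique. Goodness gives convergence of the averages of the characters
  \<open>x \<mapsto> e (k x)\<close>, hence of trigonometric polynomials, hence, by Stone-Weierstrass on the unit circle,
  of every continuous function (\<open>convergent_average\<close>). That the limit functional is integration
  against a measure comes from Helly selection: the distributions of the fractional parts of
  \<open>s\<^sub>n \<alpha>\<close> are tight on the real line, and the image on the torus of a subsequential limit must
  represent the whole limit (\<open>weak_limit_exists\<close>). Uniqueness is the comparison of measures through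
  continuous functions, with constant 1, used in both directions.
\<close>

section \<open>The torus as a quotient of the line and as the unit circle\<close>

lemma of_real_torus_eq_iff: "of_real_torus x = of_real_torus y \<longleftrightarrow> x - y \<in> \<int>"
  by (rule torus.abs_eq_iff)

text \<open>Fixes the representative in \<open>[0,1)\<close>. Unlike \<open>rep_torus\<close>, which chooses representatives
  arbitrarily, this section of the quotient map is Borel measurable.\<close>

definition unit_rep :: "torus \<Rightarrow> real" where
  "unit_rep t = frac (rep_torus t)"

lemma of_real_torus_frac: "of_real_torus (frac x) = of_real_torus x"
  by (simp add: of_real_torus_eq_iff frac_def)

lemma of_real_torus_unit_rep [simp]: "of_real_torus (unit_rep t) = t"
  unfolding unit_rep_def of_real_torus_frac by (rule Quotient_abs_rep[OF Quotient_torus])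

lemma unit_rep_bounds: "0 \<le> unit_rep t" "unit_rep t < 1"
  by (simp_all add: unit_rep_def frac_lt_1)

lemma frac_eq_if_diff_Ints:
  fixes x y :: real
  assumes "x - y \<in> \<int>" shows "frac x = frac y"
proof -
  from assms obtain k where "x - y = of_int k" by (auto elim: Ints_cases)
  then have "x = y + of_int k" by simp
  then show ?thesis by (simp add: frac_def)
qed

lemma unit_rep_of_real_torus: "unit_rep (of_real_torus x) = frac x"
proof -
  have "of_real_torus (unit_rep (of_real_torus x)) = of_real_torus x" by simp
  then have "frac (unit_rep (of_real_torus x)) = frac x"
    unfolding of_real_torus_eq_iff by (rule frac_eq_if_diff_Ints)
  then show ?thesis
    using unit_rep_bounds[of "of_real_torus x"] by (simp add: frac_eq)
qed

lemma continuous_on_torus_iff: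
  "continuous_on UNIV (f :: torus \<Rightarrow> 'a::topological_space) \<longleftrightarrow>
    continuous_on UNIV (\<lambda>x. f (of_real_torus x))"
  by (simp add: continuous_on_open_vimage open_torus_def vimage_def)

lemma continuous_of_real_torus: "continuous_on UNIV of_real_torus"
  by (simp add: continuous_on_open_vimage open_torus_def)

lemma closed_torus_iff: "closed C \<longleftrightarrow> closed (of_real_torus -` C)"
  by (simp add: closed_def open_torus_def vimage_Compl)

text \<open>The saturation of \<open>K\<close> is the Minkowski sum of the compact set \<open>K\<close> and the closed set
  \<open>\<int>\<close>.\<close>

lemma closed_of_real_torus_image:
  assumes "compact K" shows "closed (of_real_torus ` K)"
proof -
  have "of_real_torus -` (of_real_torus ` K) = (\<Union>x\<in>K. \<Union>k\<in>\<int>. {x + k})" (is "?L = ?R")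
  proof
    show "?L \<subseteq> ?R"
    proof
      fix x assume "x \<in> ?L"
      then obtain y where "y \<in> K" "x - y \<in> \<int>" by (auto simp: of_real_torus_eq_iff)
      moreover have "x = y + (x - y)" by simp
      ultimately show "x \<in> ?R" by blast
    qed
    show "?R \<subseteq> ?L"
      by (force simp: of_real_torus_eq_iff image_iff)
  qed
  then show ?thesis
    using compact_closed_sums[OF assms closed_Ints] by (simp add: closed_torus_iff)
qed

text \<open>For \<open>0 \<le> a < 1\<close> the sublevel set is the image of the compact interval \<open>[0,a]\<close>, hence closed,
  although \<open>unit_rep\<close> is discontinuous at the class of 0.\<close>

lemma measurable_unit_rep [measurable]: "unit_rep \<in> borel_measurable borel"
  unfolding borel_measurable_iff_le
proof
  fix a :: real
  have "closed {t. unit_rep t \<le> a}"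
  proof (cases "a < 1")
    case True
    have "{t. unit_rep t \<le> a} = of_real_torus ` {0..a}"
    proof (intro set_eqI iffI)
      fix t assume "t \<in> {t. unit_rep t \<le> a}"
      then show "t \<in> of_real_torus ` {0..a}"
        using unit_rep_bounds[of t] by (intro image_eqI[of _ _ "unit_rep t"]) auto
    next
      fix t assume "t \<in> of_real_torus ` {0..a}"
      then obtain x where "t = of_real_torus x" "0 \<le> x" "x \<le> a" by auto
      moreover from this True have "frac x = x" by (simp add: frac_eq)
      ultimately show "t \<in> {t. unit_rep t \<le> a}" by (simp add: unit_rep_of_real_torus)
    qed
    then show ?thesis by (simp add: closed_of_real_torus_image)
  next
    case False
    have "unit_rep t \<le> a" for t using False unit_rep_bounds(2)[of t] by linarith
    then have "{t. unit_rep t \<le> a} = UNIV" by auto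
    then show ?thesis by simp
  qed
  then show "{w \<in> space borel. unit_rep w \<le> a} \<in> sets borel"
    by (simp add: borel_closed)
qed

lemma measurable_of_real_torus [measurable]: "of_real_torus \<in> borel_measurable borel"
  by (rule borel_measurable_continuous_onI[OF continuous_of_real_torus])

lemma e_eq_cis: "e x = cis (2 * pi * x)"
  by (simp add: e_def cis_conv_exp algebra_simps)

lemma e_add: "e (x + y) = e x * e y"
  by (simp add: e_eq_cis cis_mult distrib_left)

lemma e_eq_iff: "e x = e y \<longleftrightarrow> x - y \<in> \<int>"
proof -
  have "e x = e y \<longleftrightarrow> (\<exists>k::int. x = y + of_int k)"
  proof -
    have *: "(2 * complex_of_real pi * \<i> * complex_of_real x =
       2 * complex_of_real pi * \<i> * complex_of_real y + complex_of_real (real_of_int (2 * n) * pi) * \<i>)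
       \<longleftrightarrow> x = y + of_int n" for n
    proof -
      have "(2 * complex_of_real pi * \<i> * complex_of_real x =
       2 * complex_of_real pi * \<i> * complex_of_real y + complex_of_real (real_of_int (2 * n) * pi) * \<i>)
       \<longleftrightarrow> (2 * complex_of_real pi * \<i>) * of_real x = (2 * complex_of_real pi * \<i>) * of_real (y + of_int n)"
        by (simp add: algebra_simps)
      also have "\<dots> \<longleftrightarrow> x = y + of_int n"
        unfolding mult_cancel_left of_real_eq_iff by simp
      finally show ?thesis .
    qed
    show ?thesis unfolding e_def exp_eq by (simp only: * )
  qed
  also have "\<dots> \<longleftrightarrow> x - y \<in> \<int>"
    by (metis Ints_cases Ints_of_int add_diff_cancel_left' diff_add_cancel add.commute)
  finally show ?thesis .
qed

lemma continuous_on_e: "continuous_on A e"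
  unfolding e_def[abs_def] by (intro continuous_intros)

text \<open>Identifies the torus with the unit circle. Through it the torus, given only by its
  quotient topology, inherits the Euclidean metric and the Stone-Weierstrass theorem of the plane.\<close>

definition torus_circle :: "torus \<Rightarrow> complex" where
  "torus_circle t = e (unit_rep t)"

lemma torus_circle_of_real_torus: "torus_circle (of_real_torus x) = e x"
  by (simp add: torus_circle_def unit_rep_of_real_torus e_eq_iff frac_def)

lemma continuous_torus_circle: "continuous_on UNIV torus_circle"
  by (simp add: continuous_on_torus_iff torus_circle_of_real_torus continuous_on_e)

lemma inj_torus_circle: "inj torus_circle"
proof (rule injI)
  fix s t assume "torus_circle s = torus_circle t"
  then have "of_real_torus (unit_rep s) = of_real_torus (unit_rep t)"
    unfolding torus_circle_def e_eq_iff of_real_torus_eq_iff .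
  then show "s = t" by simp
qed

lemma range_torus_circle: "range torus_circle = sphere 0 1"
proof
  show "range torus_circle \<subseteq> sphere 0 1"
    by (auto simp: torus_circle_def e_eq_cis)
  show "sphere 0 1 \<subseteq> range torus_circle"
  proof
    fix z :: complex assume "z \<in> sphere 0 1"
    then have "z = e (Arg z / (2 * pi))"
      using rcis_cmod_Arg[of z] by (simp add: e_eq_cis rcis_def)
    then show "z \<in> range torus_circle"
      by (metis torus_circle_of_real_torus rangeI)
  qed
qed

text \<open>The torus is compact: a closed set is the image of a compact part of \<open>[0,1]\<close>. Together with
  continuity and injectivity this makes \<open>torus_circle\<close> a closed embedding.\<close>

lemma closed_torus_circle_image:
  assumes "closed C" shows "closed (torus_circle ` C)"
proof -
  have "torus_circle ` C = e ` ((of_real_torus -` C) \<inter> {0..1})"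
  proof (intro set_eqI iffI)
    fix z assume "z \<in> torus_circle ` C"
    then obtain t where "t \<in> C" "z = torus_circle t" by auto
    then show "z \<in> e ` ((of_real_torus -` C) \<inter> {0..1})"
      using unit_rep_bounds[of t]
      by (intro image_eqI[of _ _ "unit_rep t"]) (auto simp: torus_circle_def)
  next
    fix z assume "z \<in> e ` ((of_real_torus -` C) \<inter> {0..1})"
    then show "z \<in> torus_circle ` C"
      by (auto simp: torus_circle_of_real_torus[symmetric])
  qed
  moreover have "compact ((of_real_torus -` C) \<inter> {0..1::real})"
    using assms by (intro closed_Int_compact) (auto simp: closed_torus_iff)
  ultimately show ?thesis
    by (auto intro!: compact_imp_closed compact_continuous_image[OF continuous_on_e])
qed

section \<open>Approximation by trigonometric polynomials\<close>

inductive trig_poly :: "(real \<Rightarrow> complex) \<Rightarrow> bool" where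
  monomial: "trig_poly (\<lambda>x. c * e (of_int k * x))"
| add: "trig_poly u \<Longrightarrow> trig_poly v \<Longrightarrow> trig_poly (\<lambda>x. u x + v x)"

lemma trig_poly_const: "trig_poly (\<lambda>x. c)"
  using trig_poly.monomial[of c 0] by (simp add: e_def)

lemma trig_poly_mult:
  assumes "trig_poly u" "trig_poly v"
  shows "trig_poly (\<lambda>x. u x * v x)"
  using assms
proof (induction arbitrary: v)
  case (monomial c k)
  from monomial show ?case
  proof (induction)
    case (monomial d l)
    have "(\<lambda>x. c * e (of_int k * x) * (d * e (of_int l * x))) =
        (\<lambda>x. (c * d) * e (of_int (k + l) * x))"
      by (simp add: fun_eq_iff distrib_right e_add)
    then show ?case by (simp only: trig_poly.monomial)
  next
    case (add u v)
    then show ?case by (simp add: distrib_left trig_poly.add)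
  qed
next
  case (add u w)
  then show ?case by (simp add: distrib_right trig_poly.add)
qed

text \<open>A real polynomial on the plane is a polynomial in \<open>Re z\<close> and \<open>Im z\<close>, which restrict to cosine
  and sine on the circle.\<close>

lemma trig_poly_real_polynomial_function:
  assumes "real_polynomial_function g"
  shows "trig_poly (\<lambda>x. of_real (g (e x)))"
  using assms
proof induction
  case (linear g)
  interpret bounded_linear g by fact
  have expand: "g z = Re z * g 1 + Im z * g \<i>" for z
  proof -
    have "z = Re z *\<^sub>R 1 + Im z *\<^sub>R \<i>" by (simp add: complex_eq_iff)
    then have "g z = g (Re z *\<^sub>R 1 + Im z *\<^sub>R \<i>)" by (rule arg_cong)
    then show ?thesis by (simp add: add scaleR)
  qed
  have cos: "complex_of_real (Re (e x)) = (1/2) * e (of_int 1 * x) + (1/2) * e (of_int (-1) * x)" for x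
    by (simp add: e_eq_cis complex_eq_iff)
  have sin: "complex_of_real (Im (e x)) = (-\<i>/2) * e (of_int 1 * x) + (\<i>/2) * e (of_int (-1) * x)" for x
    by (simp add: e_eq_cis complex_eq_iff)
  have "trig_poly (\<lambda>x. ((1/2) * e (of_int 1 * x) + (1/2) * e (of_int (-1) * x)) * of_real (g 1)
      + ((-\<i>/2) * e (of_int 1 * x) + (\<i>/2) * e (of_int (-1) * x)) * of_real (g \<i>))"
    by (intro trig_poly.add trig_poly_mult trig_poly.monomial trig_poly_const)
  then show ?case
    by (subst expand) (simp only: of_real_add of_real_mult cos sin)
qed (simp_all add: trig_poly_const trig_poly.add trig_poly_mult)

lemma trig_poly_approximation:
  fixes f :: "torus \<Rightarrow> real"
  assumes "continuous_on UNIV f" "0 < \<epsilon>"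
  obtains u where "trig_poly u" "\<And>x. norm (of_real (f (of_real_torus x)) - u x) < \<epsilon>"
proof -
  \<comment> \<open>\<open>f\<close> transported to the circle; it is continuous there because \<open>torus_circle\<close> is a closed map.\<close>
  define F where "F = (\<lambda>z. f (inv torus_circle z))"
  have F: "F (torus_circle t) = f t" for t
    by (simp add: F_def inv_f_f[OF inj_torus_circle])
  have "continuous_on (sphere 0 1) F"
  proof (subst continuous_on_closed_vimage, simp, intro allI impI)
    fix B :: "real set" assume "closed B"
    then have "closed (f -` B)"
      using assms(1) by (simp add: continuous_on_closed_vimage)
    moreover have "F -` B \<inter> sphere 0 1 = torus_circle ` (f -` B)"
      unfolding range_torus_circle[symmetric] by (auto simp: F)
    ultimately show "closed (F -` B \<inter> sphere 0 1)"
      by (simp add: closed_torus_circle_image)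
  qed
  then obtain g where g: "real_polynomial_function g" "\<And>z. z \<in> sphere 0 1 \<Longrightarrow> \<bar>F z - g z\<bar> < \<epsilon>"
    using Stone_Weierstrass_real_polynomial_function[OF compact_sphere _ assms(2)] by blast
  show thesis
  proof (rule that[OF trig_poly_real_polynomial_function[OF g(1)]])
    fix x
    have "e x \<in> sphere 0 1" by (simp add: e_eq_cis)
    from g(2)[OF this] show "norm (complex_of_real (f (of_real_torus x)) - of_real (g (e x))) < \<epsilon>"
      using F[of "of_real_torus x"]
      by (simp add: torus_circle_of_real_torus flip: of_real_diff)
  qed
qed

section \<open>Convergence of averages over a good set\<close>

lemma convergent_if_uniformly_approximable:
  fixes a :: "nat \<Rightarrow> 'a::banach"
  assumes "\<And>\<epsilon>. 0 < \<epsilon> \<Longrightarrow> \<exists>b. convergent b \<and> (\<forall>n. norm (a n - b n) \<le> \<epsilon>)"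
  shows "convergent a"
proof (rule Cauchy_convergent, rule metric_CauchyI)
  fix \<epsilon> :: real assume "0 < \<epsilon>"
  then obtain b where b: "convergent b" "\<And>n. norm (a n - b n) \<le> \<epsilon> / 4"
    using assms[of "\<epsilon> / 4"] by auto
  obtain M where M: "\<And>m n. m \<ge> M \<Longrightarrow> n \<ge> M \<Longrightarrow> dist (b m) (b n) < \<epsilon> / 2"
    using metric_CauchyD[OF convergent_Cauchy[OF b(1)], of "\<epsilon> / 2"] \<open>0 < \<epsilon>\<close> by auto
  have "dist (a m) (a n) < \<epsilon>" if "m \<ge> M" "n \<ge> M" for m n
  proof -
    have "dist (a m) (a n) \<le> dist (a m) (b m) + dist (b m) (b n) + dist (b n) (a n)"
      using dist_triangle[of "a m" "a n" "b m"] dist_triangle[of "b m" "a n" "b n"] by linarith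
    moreover have "dist (a m) (b m) \<le> \<epsilon> / 4" "dist (b n) (a n) \<le> \<epsilon> / 4"
      using b(2) by (simp_all add: dist_norm norm_minus_commute)
    ultimately show ?thesis using M[OF that] by linarith
  qed
  then show "\<exists>M. \<forall>m\<ge>M. \<forall>n\<ge>M. dist (a m) (a n) < \<epsilon>" by blast
qed

lemma convergent_average_trig_poly:
  assumes "good S" "trig_poly u"
  shows "convergent (\<lambda>N. (\<Sum>n<N. u (real (enumerate S n) * \<alpha>)) / of_nat N)"
  using assms(2)
proof induction
  case (monomial c k)
  have "convergent (\<lambda>N. (\<Sum>n<N. e (real (enumerate S n) * (of_int k * \<alpha>))) / of_nat N)"
    using assms(1) by (auto simp: good_def)
  then have "convergent (\<lambda>N. c * ((\<Sum>n<N. e (real (enumerate S n) * (of_int k * \<alpha>))) / of_nat N))"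
    by (intro convergent_mult convergent_const)
  then show ?case
    by (simp add: sum_distrib_left mult.assoc mult.left_commute)
next
  case (add u v)
  then show ?case
    by (auto simp: sum.distrib add_divide_distrib intro: convergent_add)
qed

text \<open>Goodness speaks about characters only. A uniform approximation of \<open>f\<close> within \<open>\<epsilon>\<close> by a
  trigonometric polynomial changes every average by at most \<open>\<epsilon>\<close>, so the averages of \<open>f\<close> are Cauchy.\<close>

lemma convergent_average:
  fixes f :: "torus \<Rightarrow> real"
  assumes "good S" "continuous_on UNIV f"
  shows "convergent (\<lambda>N. (\<Sum>n<N. f (of_real_torus (real (enumerate S n) * \<alpha>))) / real N)"
proof -
  define s where "s n = real (enumerate S n) * \<alpha>" for n
  let ?a = "\<lambda>N. (\<Sum>n<N. complex_of_real (f (of_real_torus (s n)))) / of_nat N"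
  have "convergent ?a"
  proof (rule convergent_if_uniformly_approximable)
    fix \<epsilon> :: real assume "0 < \<epsilon>"
    then obtain u where u: "trig_poly u"
        "\<And>x. norm (of_real (f (of_real_torus x)) - u x) < \<epsilon>"
      using trig_poly_approximation[OF assms(2)] by blast
    have "norm (?a N - (\<Sum>n<N. u (s n)) / of_nat N) \<le> \<epsilon>" for N
    proof -
      have "norm (\<Sum>n<N. complex_of_real (f (of_real_torus (s n))) - u (s n)) \<le> of_nat (card {..<N}) * \<epsilon>"
        by (intro sum_norm_bound less_imp_le u(2))
      then show ?thesis
        using \<open>0 < \<epsilon>\<close>
        by (cases "N = 0")
           (simp_all add: diff_divide_distrib[symmetric] sum_subtractf[symmetric] norm_divide
              pos_divide_le_eq mult.commute)
    qed
    moreover have "convergent (\<lambda>N. (\<Sum>n<N. u (s n)) / of_nat N)"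
      unfolding s_def by (rule convergent_average_trig_poly[OF assms(1) u(1)])
    ultimately show "\<exists>b. convergent b \<and> (\<forall>N. norm (?a N - b N) \<le> \<epsilon>)" by blast
  qed
  then obtain l where "?a \<longlonglongrightarrow> l" by (auto simp: convergent_def)
  then have "(\<lambda>N. Re (?a N)) \<longlonglongrightarrow> Re l" by (rule tendsto_Re)
  moreover have "Re (?a N) = (\<Sum>n<N. f (of_real_torus (s n))) / real N" for N
    by (simp add: Re_divide_of_nat)
  ultimately show ?thesis by (auto simp: convergent_def s_def)
qed

lemma integral_empirical_measure:
  fixes f :: "torus \<Rightarrow> real"
  assumes "continuous_on UNIV f"
  shows "(\<integral>x. f x \<partial>empirical_measure S \<alpha> N) =
    (\<Sum>n<N. f (of_real_torus (real (enumerate S n) * \<alpha>))) / real N"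
proof -
  have "(\<lambda>n. of_real_torus (real (enumerate S n) * \<alpha>)) \<in> measurable (uniform_count_measure {..<N}) borel"
    by (auto simp: measurable_def space_uniform_count_measure sets_uniform_count_measure)
  then show ?thesis
    unfolding empirical_measure_def
    by (subst integral_distr)
       (simp_all add: integral_uniform_count_measure borel_measurable_continuous_onI[OF assms])
qed

section \<open>Comparing measures through continuous functions\<close>

lemma bounded_continuous_torus:
  fixes f :: "torus \<Rightarrow> real"
  assumes "continuous_on UNIV f"
  obtains B where "\<And>t. \<bar>f t\<bar> \<le> B"
proof -
  have "compact ((\<lambda>x. f (of_real_torus x)) ` {0..1})"
    using assms unfolding continuous_on_torus_iff
    by (intro compact_continuous_image) (auto intro: continuous_on_subset)
  then obtain B where B: "\<And>x. x \<in> {0..1} \<Longrightarrow> \<bar>f (of_real_torus x)\<bar> \<le> B"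
    by (fastforce dest!: compact_imp_bounded simp: bounded_iff)
  have "\<bar>f t\<bar> \<le> B" for t
    using B[of "unit_rep t"] unit_rep_bounds[of t] by simp
  then show thesis by (rule that)
qed

text \<open>Urysohn-type functions: truncations of the distance to \<open>C\<close>, measured on the circle, decrease
  to the indicator function of \<open>C\<close>. One sequence serves all finite measures, so that two measures can
  be compared.\<close>

lemma integral_limit_closed_indicator:
  assumes "closed C"
  obtains f :: "nat \<Rightarrow> torus \<Rightarrow> real" where
    "\<And>n. continuous_on UNIV (f n)" "\<And>n t. 0 \<le> f n t"
    "\<And>M. finite_measure M \<Longrightarrow> sets M = sets borel \<Longrightarrow> (\<lambda>n. \<integral>t. f n t \<partial>M) \<longlonglongrightarrow> measure M C"
proof (cases "C = {}")
  case True
  then show thesis by (intro that[of "\<lambda>_ _. 0"]) auto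
next
  case False
  define d where "d t = infdist (torus_circle t) (torus_circle ` C)" for t
  define f where "f n t = max 0 (1 - real n * d t)" for n t
  have d_nonneg: "0 \<le> d t" for t
    by (simp add: d_def infdist_nonneg)
  have d_0: "d t = 0 \<longleftrightarrow> t \<in> C" for t
    unfolding d_def
    using in_closed_iff_infdist_zero[OF closed_torus_circle_image[OF assms], of "torus_circle t"] False
    by (simp add: inj_image_mem_iff[OF inj_torus_circle])
  have cont: "continuous_on UNIV (f n)" for n
    unfolding f_def d_def by (intro continuous_intros continuous_torus_circle)
  have pointwise: "(\<lambda>n. f n t) \<longlonglongrightarrow> indicator C t" for t
  proof (cases "t \<in> C")
    case True
    then show ?thesis using d_0[of t] by (simp add: f_def)
  next
    case False
    then have "0 < d t" using d_0[of t] d_nonneg[of t] by linarith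
    then obtain m :: nat where m: "1 < real m * d t"
      using reals_Archimedean3 by blast
    have "f n t = 0" if "n \<ge> m" for n
    proof -
      have "real m * d t \<le> real n * d t"
        using that d_nonneg by (intro mult_right_mono) auto
      then show ?thesis using m by (simp add: f_def)
    qed
    then have "eventually (\<lambda>n. f n t = 0) sequentially"
      by (auto simp: eventually_sequentially)
    then show ?thesis using False by (simp add: tendsto_eventually)
  qed
  show thesis
  proof (rule that[of f])
    show "continuous_on UNIV (f n)" for n by (rule cont)
    show "0 \<le> f n t" for n t by (simp add: f_def)
    fix M :: "torus measure" assume M: "finite_measure M" "sets M = sets borel"
    interpret finite_measure M by (rule M)
    have C: "C \<in> sets M" using assms M(2) by (simp add: borel_closed)
    have "(\<lambda>n. \<integral>t. f n t \<partial>M) \<longlonglongrightarrow> (\<integral>t. indicator C t \<partial>M)"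
    proof (rule integral_dominated_convergence[where w = "\<lambda>_. 1"])
      show "indicator C \<in> borel_measurable M" using C by simp
      show "f n \<in> borel_measurable M" for n
        using borel_measurable_continuous_onI[OF cont] by (simp add: measurable_cong_sets[OF M(2)])
      show "AE t in M. norm (f n t) \<le> 1" for n
        using d_nonneg by (auto simp: f_def)
    qed (auto simp: pointwise)
    then show "(\<lambda>n. \<integral>t. f n t \<partial>M) \<longlonglongrightarrow> measure M C"
      using C by simp
  qed
qed

text \<open>Closed sets are reached through the preceding approximation of indicators, Borel sets then by
  inner regularity. Finite measures on the real line are inner regular, so regularity is applied to the image of \<open>\<mu>\<close> under \<open>unit_rep\<close>; compact subsets of \<open>[0,1)\<close> correspond to closed
  sets of the torus.\<close>

lemma emeasure_le_if_integral_continuous_le: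
  fixes \<mu> \<nu> :: "torus measure"
  assumes "finite_measure \<mu>" "sets \<mu> = sets borel"
    and "finite_measure \<nu>" "sets \<nu> = sets borel"
    and "0 \<le> c"
    and le: "\<And>f :: torus \<Rightarrow> real. continuous_on UNIV f \<Longrightarrow> (\<And>t. 0 \<le> f t) \<Longrightarrow>
      (\<integral>t. f t \<partial>\<mu>) \<le> c * (\<integral>t. f t \<partial>\<nu>)"
    and "B \<in> sets borel"
  shows "emeasure \<mu> B \<le> ennreal c * emeasure \<nu> B"
proof -
  interpret \<mu>: finite_measure \<mu> by fact
  interpret \<nu>: finite_measure \<nu> by fact
  have closed_le: "emeasure \<mu> C \<le> ennreal c * emeasure \<nu> C" if C: "closed C" for C
  proof -
    obtain f :: "nat \<Rightarrow> torus \<Rightarrow> real" where f: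
      "\<And>n. continuous_on UNIV (f n)" "\<And>n t. 0 \<le> f n t"
      "\<And>M. finite_measure M \<Longrightarrow> sets M = sets borel \<Longrightarrow> (\<lambda>n. \<integral>t. f n t \<partial>M) \<longlonglongrightarrow> measure M C"
      using integral_limit_closed_indicator[OF C] by blast
    have "measure \<mu> C \<le> c * measure \<nu> C"
      by (rule LIMSEQ_le[OF f(3)[OF assms(1,2)] tendsto_mult_left[OF f(3)[OF assms(3,4)]]])
         (auto intro!: le f)
    then show ?thesis
      using \<open>0 \<le> c\<close> by (simp add: \<mu>.emeasure_eq_measure \<nu>.emeasure_eq_measure ennreal_mult'[symmetric] ennreal_leI)
  qed
  have [measurable]: "unit_rep \<in> borel_measurable \<mu>"
    using measurable_unit_rep by (simp add: measurable_cong_sets[OF assms(2)])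
  define B' where "B' = {x \<in> {0..<1}. of_real_torus x \<in> B}"
  have B': "B' \<in> sets borel"
    unfolding B'_def using \<open>B \<in> sets borel\<close> by measurable
  have preim: "unit_rep -` B' = B"
    using unit_rep_bounds by (auto simp: B'_def)
  let ?D = "distr \<mu> borel unit_rep"
  have space: "space \<mu> = UNIV" using sets_eq_imp_space_eq[OF assms(2)] by simp
  have "emeasure \<mu> B = emeasure ?D B'"
    using B' by (simp add: emeasure_distr preim space)
  also have "\<dots> = (SUP K \<in> {K. K \<subseteq> B' \<and> compact K}. emeasure ?D K)"
    using B' by (intro inner_regular) (auto simp: emeasure_distr space)
  also have "\<dots> \<le> ennreal c * emeasure \<nu> B"
  proof (rule SUP_least)
    fix K assume "K \<in> {K. K \<subseteq> B' \<and> compact K}"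
    then have K: "K \<subseteq> B'" "compact K" by auto
    have img: "unit_rep -` K = of_real_torus ` K"
    proof (intro set_eqI iffI)
      fix t assume "t \<in> unit_rep -` K"
      then show "t \<in> of_real_torus ` K" by (intro image_eqI[of _ _ "unit_rep t"]) auto
    next
      fix t assume "t \<in> of_real_torus ` K"
      then obtain x where x: "x \<in> K" "t = of_real_torus x" by auto
      then have "frac x = x" using K(1) by (auto simp: B'_def frac_eq)
      with x show "t \<in> unit_rep -` K" by (simp add: unit_rep_of_real_torus)
    qed
    have "emeasure ?D K = emeasure \<mu> (of_real_torus ` K)"
      using K(2) by (simp add: emeasure_distr space img borel_compact)
    also have "\<dots> \<le> ennreal c * emeasure \<nu> (of_real_torus ` K)"
      by (rule closed_le[OF closed_of_real_torus_image[OF K(2)]])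
    also have "\<dots> \<le> ennreal c * emeasure \<nu> B"
      using K(1) \<open>B \<in> sets borel\<close> assms(4)
      by (intro mult_left_mono emeasure_mono) (auto simp: B'_def)
    finally show "emeasure ?D K \<le> ennreal c * emeasure \<nu> B" .
  qed
  finally show ?thesis .
qed

section \<open>Existence and uniqueness of the limit measure\<close>

lemma weak_limit_unique:
  assumes "weak_limit M \<mu>" "weak_limit M \<nu>"
  shows "\<mu> = \<nu>"
proof (rule measure_eqI)
  interpret \<mu>: prob_space \<mu> using assms by (simp add: weak_limit_def)
  interpret \<nu>: prob_space \<nu> using assms by (simp add: weak_limit_def)
  have sets: "sets \<mu> = sets borel" "sets \<nu> = sets borel"
    using assms by (auto simp: weak_limit_def)
  then show "sets \<mu> = sets \<nu>" by simp
  have eq: "(\<integral>t. f t \<partial>\<mu>) = (\<integral>t. f t \<partial>\<nu>)" if "continuous_on UNIV f" for f :: "torus \<Rightarrow> real"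
    using assms that unfolding weak_limit_def by (meson LIMSEQ_unique)
  fix A assume "A \<in> sets \<mu>"
  then have A: "A \<in> sets borel" by (simp add: sets)
  have "emeasure \<mu> A \<le> ennreal 1 * emeasure \<nu> A"
    by (rule emeasure_le_if_integral_continuous_le[OF _ sets(1) _ sets(2) _ _ A])
       (simp_all add: eq \<mu>.finite_measure_axioms \<nu>.finite_measure_axioms)
  moreover have "emeasure \<nu> A \<le> ennreal 1 * emeasure \<mu> A"
    by (rule emeasure_le_if_integral_continuous_le[OF _ sets(2) _ sets(1) _ _ A])
       (simp_all add: eq \<mu>.finite_measure_axioms \<nu>.finite_measure_axioms)
  ultimately show "emeasure \<mu> A = emeasure \<nu> A" by simp
qed

text \<open>Helly selection provides a limit along a subsequence only. As the averages of each continuous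
  \<open>f\<close> converge along the whole sequence, that subsequential limit already determines them.\<close>

lemma weak_limit_exists:
  assumes "good S"
  shows "\<exists>\<mu>. weak_limit (empirical_measure S \<alpha>) \<mu>"
proof -
  define s where "s n = real (enumerate S n) * \<alpha>" for n
  \<comment> \<open>The shift to \<open>Suc N\<close> keeps the index set nonempty, so every \<open>\<nu> N\<close> is a probability measure.\<close>
  define U where "U N = uniform_count_measure {..<Suc N}" for N
  define \<nu> where "\<nu> N = distr (U N) borel (\<lambda>n. frac (s n))" for N
  have meas: "(\<lambda>n. frac (s n)) \<in> measurable (U N) borel" for N
    by (auto simp: U_def measurable_def sets_uniform_count_measure space_uniform_count_measure)
  have prob_U: "prob_space (U N)" for N
    unfolding U_def by (rule prob_space_uniform_count_measure) auto
  have real_dist: "real_distribution (\<nu> N)" for N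
    unfolding \<nu>_def
    using prob_space.real_distribution_distr[OF prob_U meas] by simp
  have mass: "measure (\<nu> N) {-1<..1} = 1" for N
  proof -
    interpret prob_space "U N" by (rule prob_U)
    have "-1 < frac (s n)" "frac (s n) \<le> 1" for n
      using frac_ge_0[of "s n"] frac_lt_1[of "s n"] by linarith+
    then have "(\<lambda>n. frac (s n)) -` {-1<..1} \<inter> space (U N) = space (U N)"
      by auto
    then show ?thesis
      by (simp add: \<nu>_def measure_distr[OF meas] prob_space)
  qed
  have "tight \<nu>"
    unfolding tight_def
  proof (intro conjI allI impI)
    show "real_distribution (\<nu> n)" for n by (rule real_dist)
    show "\<exists>a b. a < b \<and> (\<forall>n. 1 - \<epsilon> < measure (\<nu> n) {a<..b})" if "0 < \<epsilon>" for \<epsilon> :: real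
      using that by (intro exI[of _ "-1"] exI[of _ 1]) (simp add: mass)
  qed
  then obtain r M where r: "strict_mono r" and M: "real_distribution M"
    and weak: "weak_conv_m (\<nu> \<circ> r) M"
    using tight_imp_convergent_subsubsequence[of \<nu> "\<lambda>n. n"] by (auto simp: strict_mono_def comp_def)
  interpret M: real_distribution M by (rule M)
  define \<mu> where "\<mu> = distr M borel of_real_torus"
  have meas_M: "of_real_torus \<in> measurable M borel"
    using measurable_of_real_torus by (simp add: measurable_cong_sets[OF M.events_eq_borel])
  have "(\<lambda>N. \<integral>t. f t \<partial>empirical_measure S \<alpha> N) \<longlonglongrightarrow> (\<integral>t. f t \<partial>\<mu>)"
    if f: "continuous_on UNIV f" for f :: "torus \<Rightarrow> real"
  proof -
    let ?A = "\<lambda>N. (\<Sum>n<N. f (of_real_torus (s n))) / real N"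
    obtain B where B: "\<And>t. \<bar>f t\<bar> \<le> B" using bounded_continuous_torus[OF f] by blast
    have cont: "continuous_on UNIV (\<lambda>x. f (of_real_torus x))"
      using f by (simp add: continuous_on_torus_iff)
    have "(\<lambda>k. integral\<^sup>L ((\<nu> \<circ> r) k) (\<lambda>x. f (of_real_torus x)))
        \<longlonglongrightarrow> integral\<^sup>L M (\<lambda>x. f (of_real_torus x))"
      using cont B weak real_dist M
      by (intro weak_conv_imp_integral_bdd_continuous_conv[where B = B])
         (auto simp: continuous_on_eq_continuous_at comp_def)
    moreover have "integral\<^sup>L (\<nu> N) (\<lambda>x. f (of_real_torus x)) = ?A (Suc N)" for N
      unfolding \<nu>_def
      by (subst integral_distr[OF meas borel_measurable_continuous_onI[OF cont]])
         (simp add: U_def integral_uniform_count_measure of_real_torus_frac)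
    moreover have "integral\<^sup>L M (\<lambda>x. f (of_real_torus x)) = (\<integral>t. f t \<partial>\<mu>)"
      unfolding \<mu>_def
      by (rule integral_distr[OF meas_M borel_measurable_continuous_onI[OF f], symmetric])
    ultimately have sub: "(\<lambda>k. ?A (Suc (r k))) \<longlonglongrightarrow> (\<integral>t. f t \<partial>\<mu>)"
      by simp
    obtain l where l: "?A \<longlonglongrightarrow> l"
      using convergent_average[OF assms f, of \<alpha>] by (auto simp: convergent_def s_def)
    have "strict_mono (\<lambda>k. Suc (r k))" using r by (simp add: strict_mono_def)
    from LIMSEQ_subseq_LIMSEQ[OF l this] sub have "l = (\<integral>t. f t \<partial>\<mu>)"
      by (intro LIMSEQ_unique) (auto simp: comp_def)
    with l show ?thesis
      by (simp add: integral_empirical_measure[OF f] s_def)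
  qed
  moreover have "prob_space \<mu>" unfolding \<mu>_def by (rule M.prob_space_distr[OF meas_M])
  ultimately have "weak_limit (empirical_measure S \<alpha>) \<mu>"
    by (simp add: weak_limit_def \<mu>_def)
  then show ?thesis by blast
qed

lemma weak_limit_limit_measure:
  assumes "good S"
  shows "weak_limit (empirical_measure S \<alpha>) (limit_measure S \<alpha>)"
  unfolding limit_measure_def
  by (rule theI') (use weak_limit_exists[OF assms] weak_limit_unique in blast)

lemma average_tendsto_limit_measure:
  fixes f :: "torus \<Rightarrow> real"
  assumes "good S" "continuous_on UNIV f"
  shows "(\<lambda>N. (\<Sum>n<N. f (of_real_torus (real (enumerate S n) * \<alpha>))) / real N)
    \<longlonglongrightarrow> (\<integral>t. f t \<partial>limit_measure S \<alpha>)"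
  using weak_limit_limit_measure[OF assms(1), of \<alpha>] assms(2)
  by (simp add: weak_limit_def integral_empirical_measure)

section \<open>Counting in initial segments\<close>

lemma enumerate_image_initial_segment:
  fixes S :: "nat set"
  assumes "infinite S"
  shows "enumerate S ` {..<card (S \<inter> {..N})} = S \<inter> {..N}"
proof -
  define I where "I = {n. enumerate S n \<le> N}"
  have img: "enumerate S ` I = S \<inter> {..N}"
  proof (intro set_eqI iffI)
    fix s assume "s \<in> enumerate S ` I"
    then show "s \<in> S \<inter> {..N}" using enumerate_in_set[OF assms] by (auto simp: I_def)
  next
    fix s assume s: "s \<in> S \<inter> {..N}"
    then obtain n where "enumerate S n = s" using enumerate_Ex[OF assms, of s] by auto
    with s show "s \<in> enumerate S ` I" by (auto simp: I_def)
  qed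
  have inj: "inj_on (enumerate S) I"
    using inj_enumerate[OF assms] by (rule inj_on_subset) simp
  have "finite I"
    using img inj by (metis finite_Int finite_atMost finite_imageD)
  have down: "m \<in> I" if "n \<in> I" "m \<le> n" for m n
    using that enumerate_mono_le_iff[OF assms, of m n] unfolding I_def by (auto intro: order_trans)
  have "\<exists>k. I = {..<k}"
  proof (intro exI set_eqI iffI)
    let ?k = "LEAST k. k \<notin> I"
    have k: "?k \<notin> I"
      by (rule LeastI_ex) (rule ex_new_if_finite[OF infinite_UNIV_nat \<open>finite I\<close>])
    show "n \<in> {..<?k}" if "n \<in> I" for n
      using k down[OF that, of ?k] by (auto simp: not_le[symmetric])
    show "n \<in> I" if "n \<in> {..<?k}" for n
      using not_less_Least[of n "\<lambda>k. k \<notin> I"] that by simp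
  qed
  then obtain k where "I = {..<k}" by blast
  moreover have "card (S \<inter> {..N}) = card I"
    using card_image[OF inj] img by simp
  ultimately show ?thesis using img by simp
qed

text \<open>Translates between averages over the first elements of \<open>S\<close>, as in goodness and the limit
  measure, and averages over \<open>S(N)\<close>, as in the relative mean. The two index sets agree because
  \<open>0 \<notin> S\<close>.\<close>

lemma sum_enumerate_initial_segment:
  fixes S :: "nat set"
  assumes "good S"
  shows "(\<Sum>n<card (S \<inter> {1..N}). g (enumerate S n)) = (\<Sum>s\<in>S \<inter> {1..N}. g s)"
proof -
  have inf: "infinite S" and "0 \<notin> S" using assms by (auto simp: good_def)
  have eq: "S \<inter> {..N} = S \<inter> {1..N}"
  proof (intro set_eqI)
    fix n show "n \<in> S \<inter> {..N} \<longleftrightarrow> n \<in> S \<inter> {1..N}"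
      using \<open>0 \<notin> S\<close> by (cases n) auto
  qed
  have "(\<Sum>s\<in>enumerate S ` {..<card (S \<inter> {1..N})}. g s) =
      (\<Sum>n<card (S \<inter> {1..N}). g (enumerate S n))"
    by (simp add: sum.reindex inj_on_subset[OF inj_enumerate[OF inf]])
  then show ?thesis
    using enumerate_image_initial_segment[OF inf, of N] by (simp add: eq)
qed

lemma filterlim_card_initial_segment:
  assumes "good S"
  shows "filterlim (\<lambda>N. card (S \<inter> {1..N})) at_top sequentially"
  unfolding filterlim_at_top
proof
  fix k
  have inf: "infinite S" and "0 \<notin> S" using assms by (auto simp: good_def)
  show "eventually (\<lambda>N. k \<le> card (S \<inter> {1..N})) sequentially"
    using eventually_ge_at_top[of "enumerate S k"]
  proof eventually_elim
    case (elim N)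
    have "enumerate S ` {..<k} \<subseteq> S \<inter> {1..N}"
    proof
      fix s assume "s \<in> enumerate S ` {..<k}"
      then obtain n where n: "n < k" "s = enumerate S n" by auto
      then have "s \<in> S" "s \<le> N"
        using enumerate_in_set[OF inf, of n] enumerate_mono[OF n(1) inf] elim by simp_all
      moreover have "s \<noteq> 0" using \<open>s \<in> S\<close> \<open>0 \<notin> S\<close> by metis
      ultimately show "s \<in> S \<inter> {1..N}" by simp
    qed
    then have "card (enumerate S ` {..<k}) \<le> card (S \<inter> {1..N})"
      by (intro card_mono) auto
    then show ?case
      by (simp add: card_image inj_on_subset[OF inj_enumerate[OF inf]])
  qed
qed

section \<open>Positive upper relative density bounds the density function\<close>

text \<open>The density bound is only assumed for infinitely many \<open>N\<close>; this suffices because the averages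
  over \<open>S(N)\<close> and \<open>R(N)\<close> converge, so a strict violation in the limit would persist for all large
  \<open>N\<close>, in particular for one with the density bound.\<close>

lemma integral_limit_measure_le:
  fixes f :: "torus \<Rightarrow> real"
  assumes "good R" "good S" "S \<subseteq> R" "0 < \<delta>"
    and freq: "\<exists>\<^sub>F N in sequentially. \<delta> \<le> real (card (S \<inter> {1..N})) / real (card (R \<inter> {1..N}))"
    and f: "continuous_on UNIV f" "\<And>t. 0 \<le> f t"
  shows "(\<integral>t. f t \<partial>limit_measure S \<alpha>) \<le> (1 / \<delta>) * (\<integral>t. f t \<partial>limit_measure R \<alpha>)"
proof (rule ccontr)
  define g where "g n = f (of_real_torus (real n * \<alpha>))" for n
  define avg where "avg T N = (\<Sum>n\<in>T \<inter> {1..N}. g n) / real (card (T \<inter> {1..N}))" for T N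
  have avg_lim: "avg T \<longlonglongrightarrow> (\<integral>t. f t \<partial>limit_measure T \<alpha>)" if "good T" for T
    using filterlim_compose[OF average_tendsto_limit_measure[OF that f(1), of \<alpha>]
        filterlim_card_initial_segment[OF that]]
    by (simp add: avg_def[abs_def] g_def[symmetric] sum_enumerate_initial_segment[OF that] del: One_nat_def)
  assume "\<not> ?thesis"
  then have "0 < (\<integral>t. f t \<partial>limit_measure S \<alpha>) - (1 / \<delta>) * (\<integral>t. f t \<partial>limit_measure R \<alpha>)"
    by simp
  moreover have "(\<lambda>N. avg S N - (1 / \<delta>) * avg R N) \<longlonglongrightarrow>
      (\<integral>t. f t \<partial>limit_measure S \<alpha>) - (1 / \<delta>) * (\<integral>t. f t \<partial>limit_measure R \<alpha>)"
    by (intro tendsto_intros avg_lim assms)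
  ultimately have "eventually (\<lambda>N. 0 < avg S N - (1 / \<delta>) * avg R N) sequentially"
    by (intro order_tendstoD)
  with freq have "\<exists>\<^sub>F N in sequentially. \<delta> \<le> real (card (S \<inter> {1..N})) / real (card (R \<inter> {1..N})) \<and>
      0 < avg S N - (1 / \<delta>) * avg R N"
    by (rule frequently_eventually_conj[of _ _ _, THEN frequently_mono[rotated]]) auto
  then obtain N where N: "\<delta> \<le> real (card (S \<inter> {1..N})) / real (card (R \<inter> {1..N}))"
      "0 < avg S N - (1 / \<delta>) * avg R N"
    by (auto dest: frequently_ex)
  let ?a = "real (card (S \<inter> {1..N}))" and ?b = "real (card (R \<inter> {1..N}))"
  have "0 < ?b" "0 < ?a"
    using N(1) \<open>0 < \<delta>\<close> by (auto intro!: gr0I simp: zero_less_divide_iff)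
  have "\<delta> * ?b \<le> ?a" using N(1) \<open>0 < ?b\<close> by (simp add: pos_le_divide_eq)
  have sum_le: "(\<Sum>n\<in>S \<inter> {1..N}. g n) \<le> (\<Sum>n\<in>R \<inter> {1..N}. g n)"
    using assms(3) f(2) by (intro sum_mono2) (auto simp: g_def)
  have "avg S N \<le> (\<Sum>n\<in>R \<inter> {1..N}. g n) / (\<delta> * ?b)"
    unfolding avg_def using sum_le \<open>\<delta> * ?b \<le> ?a\<close> \<open>0 < \<delta>\<close> \<open>0 < ?b\<close> f(2)
    by (intro frac_le) (auto simp: g_def intro!: sum_nonneg)
  also have "\<dots> = (1 / \<delta>) * avg R N" by (simp add: avg_def)
  finally show False using N(2) by simp
qed

text \<open>Testing the inequality on \<open>A = {\<rho> > c}\<close> gives that the integral of the positive function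
  \<open>\<rho> - c\<close> over \<open>A\<close> is at most 0, so \<open>A\<close> is a null set.\<close>

lemma AE_le_if_density_le:
  fixes \<rho> :: "'a \<Rightarrow> real"
  assumes "finite_measure M" "integrable M \<rho>"
    and le: "\<And>A. A \<in> sets M \<Longrightarrow>
      emeasure (density M (\<lambda>x. ennreal (\<rho> x))) A \<le> ennreal c * emeasure M A"
    and "0 \<le> c"
  shows "AE x in M. \<rho> x \<le> c"
proof -
  interpret finite_measure M by fact
  have [measurable]: "\<rho> \<in> borel_measurable M" using assms(2) by simp
  define A where "A = {x \<in> space M. c < \<rho> x}"
  have A [measurable]: "A \<in> sets M" unfolding A_def by measurable
  have int: "integrable M (\<lambda>x. indicator A x * (\<rho> x - c))"
    using integrable_mult_indicator[OF A, of "\<lambda>x. \<rho> x - c"] assms(2) by simp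
  have nonneg: "0 \<le> indicator A x * (\<rho> x - c)" for x
    by (auto simp: A_def indicator_def)
  have int\<rho>: "integrable M (\<lambda>x. indicator A x * \<rho> x)"
    using integrable_mult_indicator[OF A assms(2)] by simp
  have nonneg\<rho>: "0 \<le> indicator A x * \<rho> x" for x
    using \<open>0 \<le> c\<close> by (auto simp: A_def indicator_def)
  have "ennreal (\<integral>x. indicator A x * \<rho> x \<partial>M) = (\<integral>\<^sup>+x. ennreal (indicator A x * \<rho> x) \<partial>M)"
    by (rule nn_integral_eq_integral[symmetric, OF int\<rho>]) (simp add: nonneg\<rho>)
  also have "\<dots> = emeasure (density M (\<lambda>x. ennreal (\<rho> x))) A"
    by (subst emeasure_density)
       (auto intro!: nn_integral_cong simp: indicator_def)
  also have "\<dots> \<le> ennreal (c * measure M A)"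
    using le[OF A] \<open>0 \<le> c\<close> by (simp add: emeasure_eq_measure ennreal_mult')
  finally have "(\<integral>x. indicator A x * \<rho> x \<partial>M) \<le> c * measure M A"
    using \<open>0 \<le> c\<close> by (simp add: ennreal_le_iff)
  moreover have "(\<integral>x. indicator A x * (\<rho> x - c) \<partial>M) = (\<integral>x. indicator A x * \<rho> x \<partial>M) - c * measure M A"
  proof -
    have "(\<integral>x. indicator A x * (\<rho> x - c) \<partial>M) = (\<integral>x. indicator A x * \<rho> x - c * indicator A x \<partial>M)"
      by (simp add: right_diff_distrib mult.commute)
    also have "\<dots> = (\<integral>x. indicator A x * \<rho> x \<partial>M) - (\<integral>x. c * indicator A x \<partial>M)"
      using int\<rho> by (intro Bochner_Integration.integral_diff) (simp_all add: emeasure_eq_measure)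
    finally show ?thesis by simp
  qed
  ultimately have "(\<integral>x. indicator A x * (\<rho> x - c) \<partial>M) \<le> 0" by simp
  then have "(\<integral>x. indicator A x * (\<rho> x - c) \<partial>M) = 0"
    by (intro antisym Bochner_Integration.integral_nonneg nonneg)
  then have "AE x in M. indicator A x * (\<rho> x - c) = 0"
    using integral_nonneg_eq_0_iff_AE[OF int] nonneg by simp
  then show ?thesis
    using AE_space by eventually_elim (auto simp: A_def indicator_def split: if_splits)
qed

theorem mainTheorem7:
  fixes R S :: "nat set" and \<alpha> :: real and \<rho> :: "torus \<Rightarrow> real"
  assumes "good R"
    and "\<alpha> \<notin> \<rat>"
    and "integrable (limit_measure R \<alpha>) \<rho>"
    and "AE x in limit_measure R \<alpha>. 0 \<le> \<rho> x"
    and "(\<integral>x. \<rho> x \<partial>limit_measure R \<alpha>) = 1"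
    and "esssup (limit_measure R \<alpha>) (\<lambda>x. ereal \<bar>\<rho> x\<bar>) = \<infinity>"
    and "good S"
    and "S \<subseteq> R"
    and "limit_measure S \<alpha> = density (limit_measure R \<alpha>) (\<lambda>x. ennreal (\<rho> x))"
  shows "has_relative_mean R S 0"
proof (rule ccontr)
  let ?q = "\<lambda>N. real (card (S \<inter> {1..N})) / real (card (R \<inter> {1..N}))"
  assume "\<not> has_relative_mean R S 0"
  then obtain \<delta> where "0 < \<delta>" and freq: "\<exists>\<^sub>F N in sequentially. \<delta> \<le> ?q N"
    unfolding has_relative_mean_def tendsto_iff
    by (auto simp: not_eventually not_less)
  have wR: "weak_limit (empirical_measure R \<alpha>) (limit_measure R \<alpha>)"
    and wS: "weak_limit (empirical_measure S \<alpha>) (limit_measure S \<alpha>)"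
    using assms(1,7) by (simp_all add: weak_limit_limit_measure)
  have setsR: "sets (limit_measure R \<alpha>) = sets borel" and setsS: "sets (limit_measure S \<alpha>) = sets borel"
    and finR: "finite_measure (limit_measure R \<alpha>)" and finS: "finite_measure (limit_measure S \<alpha>)"
    using wR wS by (auto simp: weak_limit_def prob_space_def)
  have "AE t in limit_measure R \<alpha>. \<rho> t \<le> 1 / \<delta>"
  proof (rule AE_le_if_density_le[OF finR assms(3)])
    fix A assume "A \<in> sets (limit_measure R \<alpha>)"
    then have "emeasure (limit_measure S \<alpha>) A \<le> ennreal (1 / \<delta>) * emeasure (limit_measure R \<alpha>) A"
      using \<open>0 < \<delta>\<close> integral_limit_measure_le[OF assms(1,7,8) \<open>0 < \<delta>\<close> freq]
      by (intro emeasure_le_if_integral_continuous_le finR finS setsR setsS) (auto simp: setsR)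
    then show "emeasure (density (limit_measure R \<alpha>) (\<lambda>t. ennreal (\<rho> t))) A
        \<le> ennreal (1 / \<delta>) * emeasure (limit_measure R \<alpha>) A"
      by (simp only: assms(9)[symmetric])
  qed (use \<open>0 < \<delta>\<close> in simp)
  with assms(4) have "AE t in limit_measure R \<alpha>. ereal \<bar>\<rho> t\<bar> \<le> ereal (1 / \<delta>)"
    by eventually_elim simp
  moreover have "(\<lambda>t. ereal \<bar>\<rho> t\<bar>) \<in> borel_measurable (limit_measure R \<alpha>)"
    using borel_measurable_integrable[OF assms(3)] by measurable
  ultimately have "esssup (limit_measure R \<alpha>) (\<lambda>t. ereal \<bar>\<rho> t\<bar>) \<le> ereal (1 / \<delta>)"
    by (intro esssup_I)
  with assms(6) show False by simp
qed

end
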